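(* Let $n \ge 1$, let $Q, A_1, A_2, A_3, A_4 \in \mathbb{H}^{n\times n}$ be quaternion Hermitian matrices, let $q, b_1, b_2, b_3, b_4 \in \mathbb{H}^n$ and $c_1,c_2,c_3,c_4 \in \mathbb{R}$. Consider the quaternion quadratically constrained quadratic program $$\text{(QCQP)}\quad \max_{x \in \mathbb{H}^n}\ x^H Q x + 2\,\mathrm{Re}(x^H q) \quad \text{s.t.}\quad x^H A_j x + 2\,\mathrm{Re}(x^H b_j) + c_j \le 0,\quad j = 1,2,3,4,$$ and its semidefinite relaxation $$\text{(QCQPR)}\quad \max_{X}\ B_0 \bullet X \quad \text{s.t.}\quad B_j \bullet X \le 0,\ j=1,2,3,4,\quad B_5 \bullet X = 1,\quad X \succeq 0,$$ where $X$ ranges over the $(n+1)\times(n+1)$ quaternion Hermitian matrices and $$B_0 = \begin{bmatrix} 0 & q^H \\ q & Q \end{bmatrix},\qquad B_j = \begin{bmatrix} c_j & b_j^H \\ b_j & A_j \end{bmatrix}\ (j=1,2,3,4),\qquad B_5 = \begin{bmatrix} 1 & 0 \\ 0 & 0 \end{bmatrix}.$$ Suppose that (QCQP) satisfies the Slater condition: there exists $x_0 \in \mathbb{H}^n$ such that $x_0^H A_j x_0 + 2\,\mathrm{Re}(x_0^H b_j) + c_j < 0$ for $j=1,2,3,4$. Then (QCQP) and (QCQPR) have the same optimal value. Moreover, from an optimal solution of (QCQPR) one can construct an optimal solution of (QCQP).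
   Context: $\mathbb{H}$ denotes the real quaternions, with basis $1, i, j, k$, where $i^2=j^2=k^2=ijk=-1$; the conjugate of $p = a+bi+cj+dk$ is $\overline{p} = a-bi-cj-dk$ and $\mathrm{Re}\, p = a$. Vectors in $\mathbb{H}^n$ are column vectors, and $A^H = (\overline{A})^\top$ is the conjugate transpose. A square quaternion matrix $A$ is Hermitian if $A = A^H$; then $u^H A u$ is real for all quaternion vectors $u$. For a Hermitian matrix $X$, $X \succeq 0$ means $u^H X u \ge 0$ for all quaternion vectors $u$. The inner product of square quaternion matrices of the same size is $A \bullet B = \mathrm{Re}(\mathrm{tr}(A^H B))$. An optimal solution is a feasible point attaining the optimal value. *)

theory Defs
  imports "HOL-Analysis.Analysis"
begin

datatype quat = Quat (qRe: real) (qIm1: real) (qIm2: real) (qIm3: real)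

lemma quat_eq_iff:
  "x = y \<longleftrightarrow> qRe x = qRe y \<and> qIm1 x = qIm1 y \<and> qIm2 x = qIm2 y \<and> qIm3 x = qIm3 y"
  by (cases x; cases y) auto

instantiation quat :: real_algebra_1
begin

definition zero_quat where "0 = Quat 0 0 0 0"

definition one_quat where "1 = Quat 1 0 0 0"

definition plus_quat where
  "x + y = Quat (qRe x + qRe y) (qIm1 x + qIm1 y) (qIm2 x + qIm2 y) (qIm3 x + qIm3 y)"

definition uminus_quat where
  "- x = Quat (- qRe x) (- qIm1 x) (- qIm2 x) (- qIm3 x)"

definition minus_quat where
  "x - y = Quat (qRe x - qRe y) (qIm1 x - qIm1 y) (qIm2 x - qIm2 y) (qIm3 x - qIm3 y)"

definition times_quat where
  "x * y = Quat
    (qRe x * qRe y - qIm1 x * qIm1 y - qIm2 x * qIm2 y - qIm3 x * qIm3 y)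
    (qRe x * qIm1 y + qIm1 x * qRe y + qIm2 x * qIm3 y - qIm3 x * qIm2 y)
    (qRe x * qIm2 y - qIm1 x * qIm3 y + qIm2 x * qRe y + qIm3 x * qIm1 y)
    (qRe x * qIm3 y + qIm1 x * qIm2 y - qIm2 x * qIm1 y + qIm3 x * qRe y)"

definition scaleR_quat where
  "r *\<^sub>R x = Quat (r * qRe x) (r * qIm1 x) (r * qIm2 x) (r * qIm3 x)"

instance
  by standard
    (simp_all add: quat_eq_iff zero_quat_def one_quat_def plus_quat_def uminus_quat_def
      minus_quat_def times_quat_def scaleR_quat_def algebra_simps)

end

lemma quat_sel_simps [simp]:
  "qRe 0 = 0" "qIm1 0 = 0" "qIm2 0 = 0" "qIm3 0 = 0"
  "qRe 1 = 1" "qIm1 1 = 0" "qIm2 1 = 0" "qIm3 1 = 0"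
  "qRe (x + y) = qRe x + qRe y" "qIm1 (x + y) = qIm1 x + qIm1 y"
  "qIm2 (x + y) = qIm2 x + qIm2 y" "qIm3 (x + y) = qIm3 x + qIm3 y"
  "qRe (- x) = - qRe x" "qIm1 (- x) = - qIm1 x"
  "qIm2 (- x) = - qIm2 x" "qIm3 (- x) = - qIm3 x"
  "qRe (x - y) = qRe x - qRe y" "qIm1 (x - y) = qIm1 x - qIm1 y"
  "qIm2 (x - y) = qIm2 x - qIm2 y" "qIm3 (x - y) = qIm3 x - qIm3 y"
  "qRe (r *\<^sub>R x) = r * qRe x" "qIm1 (r *\<^sub>R x) = r * qIm1 x"
  "qIm2 (r *\<^sub>R x) = r * qIm2 x" "qIm3 (r *\<^sub>R x) = r * qIm3 x"
  by (simp_all add: zero_quat_def one_quat_def plus_quat_def uminus_quat_def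
      minus_quat_def scaleR_quat_def)

lemma quat_of_real: "of_real r = Quat r 0 0 0"
  by (simp add: of_real_def quat_eq_iff)

lemma quat_hamilton:
  defines "i \<equiv> Quat 0 1 0 0" and "j \<equiv> Quat 0 0 1 0" and "k \<equiv> Quat 0 0 0 1"
  shows "i * i = - 1" "j * j = - 1" "k * k = - 1" "i * j * k = - 1"
    "Quat r1 r2 r3 r4 = of_real r1 + of_real r2 * i + of_real r3 * j + of_real r4 * k"
  by (simp_all add: i_def j_def k_def quat_of_real times_quat_def quat_eq_iff)

definition qcnj :: "quat \<Rightarrow> quat" where
  "qcnj x = Quat (qRe x) (- qIm1 x) (- qIm2 x) (- qIm3 x)"

lemma qcnj_sel [simp]:
  "qRe (qcnj x) = qRe x" "qIm1 (qcnj x) = - qIm1 x"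
  "qIm2 (qcnj x) = - qIm2 x" "qIm3 (qcnj x) = - qIm3 x"
  by (simp_all add: qcnj_def)

lemma qcnj_add: "qcnj (x + y) = qcnj x + qcnj y"
  by (simp add: quat_eq_iff)

lemma qcnj_mult: "qcnj (x * y) = qcnj y * qcnj x"
  by (simp add: quat_eq_iff times_quat_def algebra_simps)

lemma qcnj_qcnj [simp]: "qcnj (qcnj x) = x"
  by (simp add: quat_eq_iff)

lemma qcnj_sum: "qcnj (\<Sum>i\<in>I. f i) = (\<Sum>i\<in>I. qcnj (f i))"
proof (induction I rule: infinite_finite_induct)
  case (insert i I)
  then show ?case by (simp add: qcnj_add)
qed (simp_all add: quat_eq_iff)

definition conj_transpose :: "quat^'n^'m \<Rightarrow> quat^'m^'n" where
  "conj_transpose A = (\<chi> i j. qcnj (A $ j $ i))"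

definition hermitian :: "quat^'n^'n \<Rightarrow> bool" where
  "hermitian A \<longleftrightarrow> A = conj_transpose A"

(* The scalar u^H v for column vectors u, v. *)
definition hprod :: "quat^'n \<Rightarrow> quat^'n \<Rightarrow> quat" where
  "hprod u v = (\<Sum>i\<in>UNIV. qcnj (u $ i) * v $ i)"

lemma qcnj_hprod: "qcnj (hprod u v) = hprod v u"
  by (simp add: hprod_def qcnj_sum qcnj_mult)

lemma hprod_conj_transpose: "hprod (conj_transpose A *v u) v = hprod u (A *v v)"
proof -
  have "hprod (conj_transpose A *v u) v
      = (\<Sum>i\<in>UNIV. \<Sum>j\<in>UNIV. qcnj (u $ j) * A $ j $ i * v $ i)"
    by (simp add: hprod_def conj_transpose_def matrix_vector_mult_def qcnj_sum qcnj_mult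
        sum_distrib_right)
  also have "\<dots> = (\<Sum>j\<in>UNIV. \<Sum>i\<in>UNIV. qcnj (u $ j) * A $ j $ i * v $ i)"
    by (rule sum.swap)
  also have "\<dots> = hprod u (A *v v)"
    by (simp add: hprod_def matrix_vector_mult_def sum_distrib_left mult.assoc)
  finally show ?thesis .
qed

(* The form u^H A u is real for Hermitian A, so taking its real part below loses nothing. *)
definition hform :: "quat^'n^'n \<Rightarrow> quat^'n \<Rightarrow> real" where
  "hform A u = qRe (hprod u (A *v u))"

lemma hform_real:
  assumes "hermitian A"
  shows "hprod u (A *v u) = of_real (hform A u)"
proof -
  have "qcnj (hprod u (A *v u)) = hprod u (A *v u)"
    using hprod_conj_transpose[of A u u] assms by (simp add: qcnj_hprod hermitian_def)
  then show ?thesis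
    by (simp add: hform_def quat_of_real quat_eq_iff)
qed

definition psd :: "quat^'n^'n \<Rightarrow> bool" where
  "psd X \<longleftrightarrow> hermitian X \<and> (\<forall>u. hform X u \<ge> 0)"

definition minner :: "quat^'n^'n \<Rightarrow> quat^'n^'n \<Rightarrow> real" where
  "minner A B = qRe (trace (conj_transpose A ** B))"

(* The block matrix with rows (c, b^H) and (b, A). In the index type 'n option, None is the
   first index and Some i the index of the i-th coordinate of b. *)
definition bordered :: "real \<Rightarrow> quat^'n \<Rightarrow> quat^'n^'n \<Rightarrow> quat^('n option)^('n option)" where
  "bordered c b A = (\<chi> i j. case (i, j) of
     (None, None) \<Rightarrow> of_real c
   | (None, Some j') \<Rightarrow> qcnj (b $ j')
   | (Some i', None) \<Rightarrow> b $ i'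
   | (Some i', Some j') \<Rightarrow> A $ i' $ j')"

(* Possibly infinite: an unbounded problem has value infinity. *)
definition opt_value :: "'a set \<Rightarrow> ('a \<Rightarrow> real) \<Rightarrow> ereal" where
  "opt_value S f = (SUP x\<in>S. ereal (f x))"

definition opt_solution :: "'a set \<Rightarrow> ('a \<Rightarrow> real) \<Rightarrow> 'a \<Rightarrow> bool" where
  "opt_solution S f x \<longleftrightarrow> x \<in> S \<and> ereal (f x) = opt_value S f"

definition quadfun :: "quat^'n^'n \<Rightarrow> quat^'n \<Rightarrow> real \<Rightarrow> quat^'n \<Rightarrow> real" where
  "quadfun A b c x = hform A x + 2 * qRe (hprod x b) + c"

definition qcqp_feasible ::
  "(nat \<Rightarrow> quat^'n^'n) \<Rightarrow> (nat \<Rightarrow> quat^'n) \<Rightarrow> (nat \<Rightarrow> real) \<Rightarrow> (quat^'n) set" where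
  "qcqp_feasible A b c = {x. \<forall>j\<in>{1..4}. quadfun (A j) (b j) (c j) x \<le> 0}"

definition qcqpr_feasible ::
  "(nat \<Rightarrow> quat^'n^'n) \<Rightarrow> (nat \<Rightarrow> quat^'n) \<Rightarrow> (nat \<Rightarrow> real)
    \<Rightarrow> (quat^('n option)^('n option)) set" where
  "qcqpr_feasible A b c =
     {X. hermitian X \<and>
         (\<forall>j\<in>{1..4}. minner (bordered (c j) (b j) (A j)) X \<le> 0) \<and>
         minner (bordered 1 0 0) X = 1 \<and> psd X}"

end

theory Submission
  imports Defs
begin

text \<open>
  A positive semidefinite X is a sum of rank-one matrices x x^H (symmetric elimination). Replacing two
  of the vectors u, v by rotated ones (t u + v w, u - t v w, normalised, with a unit quaternion w)
  leaves the sum unchanged; since w has four real degrees of freedom, this equalises the values of the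
  four constraint forms over all summands, so that every summand satisfies all homogenised constraints.
  A summand with first coordinate t nonzero is (1, y) t for a feasible point y of (QCQP) and
  contributes |t|^2 times the objective at y, and the weights |t|^2 add up to 1. A summand with t = 0
  is a direction d with d^H A_j d nonpositive. If d^H Q d were positive, (QCQP) would be unbounded
  along a ray x + s d w: the four real parameters of w suffice to make the four terms linear in s
  nonpositive. Hence (QCQP) is unbounded or has a feasible point at least as good as X.
\<close>

section \<open>Squared norm, conjugation and real part of quaternions\<close>

definition qnorm2 :: "quat \<Rightarrow> real" where
  "qnorm2 w = (qRe w)\<^sup>2 + (qIm1 w)\<^sup>2 + (qIm2 w)\<^sup>2 + (qIm3 w)\<^sup>2"

lemma qnorm2_nonneg [simp]: "0 \<le> qnorm2 w"
  by (simp add: qnorm2_def)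

lemma qnorm2_eq_0_iff [simp]: "qnorm2 w = 0 \<longleftrightarrow> w = 0"
  unfolding qnorm2_def by (auto simp: quat_eq_iff add_nonneg_eq_0_iff)

lemma qnorm2_pos: "w \<noteq> 0 \<Longrightarrow> 0 < qnorm2 w"
  using qnorm2_nonneg[of w] qnorm2_eq_0_iff[of w] by linarith

lemma qnorm2_scaleR: "qnorm2 (r *\<^sub>R w) = r\<^sup>2 * qnorm2 w"
  by (simp add: qnorm2_def power_mult_distrib algebra_simps)

lemma qcnj_times_self: "qcnj w * w = of_real (qnorm2 w)"
  by (simp add: quat_of_real quat_eq_iff times_quat_def qnorm2_def power2_eq_square algebra_simps)

lemma times_qcnj_self: "w * qcnj w = of_real (qnorm2 w)"
  by (simp add: quat_of_real quat_eq_iff times_quat_def qnorm2_def power2_eq_square algebra_simps)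

lemma qRe_of_real [simp]: "qRe (of_real r) = r"
  by (simp add: quat_of_real)

lemma qcnj_0 [simp]: "qcnj 0 = 0" and qcnj_1 [simp]: "qcnj 1 = 1"
  and qcnj_of_real [simp]: "qcnj (of_real r) = of_real r"
  and qcnj_diff: "qcnj (x - y) = qcnj x - qcnj y"
  and qcnj_scaleR: "qcnj (r *\<^sub>R x) = r *\<^sub>R qcnj x"
  by (simp_all add: quat_eq_iff quat_of_real)

lemma qRe_mult_commute: "qRe (x * y) = qRe (y * x)"
  by (simp add: times_quat_def)

lemma qRe_sum: "qRe (\<Sum>i\<in>I. f i) = (\<Sum>i\<in>I. qRe (f i))"
  by (induction I rule: infinite_finite_induct) auto

section \<open>Right scalar multiples, the product u^H v and Hermitian forms\<close>

text \<open>Scalars act on the right, so that they commute with matrices acting on the left.\<close>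

definition rmul :: "quat^'n \<Rightarrow> quat \<Rightarrow> quat^'n" where
  "rmul v w = (\<chi> i. v $ i * w)"

lemma hprod_add_right: "hprod u (v + w) = hprod u v + hprod u w"
  by (simp add: hprod_def ring_distribs sum.distrib)

lemma hprod_add_left: "hprod (u + v) w = hprod u w + hprod v w"
  by (simp add: hprod_def ring_distribs sum.distrib qcnj_add)

lemma hprod_diff_right: "hprod u (v - w) = hprod u v - hprod u w"
  by (simp add: hprod_def ring_distribs sum_subtractf)

lemma hprod_scaleR_right: "hprod u (r *\<^sub>R v) = r *\<^sub>R hprod u v"
  by (simp add: hprod_def scaleR_sum_right)

lemma hprod_scaleR_left: "hprod (r *\<^sub>R u) v = r *\<^sub>R hprod u v"
  by (simp add: hprod_def scaleR_sum_right qcnj_scaleR)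

lemma hprod_rmul_right: "hprod u (rmul v w) = hprod u v * w"
  by (simp add: hprod_def rmul_def sum_distrib_right mult.assoc)

lemma hprod_rmul_left: "hprod (rmul u w) v = qcnj w * hprod u v"
  by (simp add: hprod_def rmul_def sum_distrib_left mult.assoc qcnj_mult)

lemma hprod_axis_right: "hprod u (axis i 1) = qcnj (u $ i)"
  by (simp add: hprod_def axis_def if_distrib cong: if_cong)

lemma hprod_axis_left: "hprod (axis i 1) u = u $ i"
  by (metis hprod_axis_right qcnj_hprod qcnj_qcnj)

lemma qRe_hprod_commute: "qRe (hprod u v) = qRe (hprod v u)"
  by (metis qcnj_hprod qcnj_sel(1))

lemma mult_vec_rmul: "A *v rmul v w = rmul (A *v v) w"
  by (simp add: vec_eq_iff matrix_vector_mult_def rmul_def sum_distrib_right mult.assoc)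

lemma mult_vec_scaleR: "(A :: quat^'n^'m) *v (r *\<^sub>R v) = r *\<^sub>R (A *v v)"
  by (simp add: vec_eq_iff matrix_vector_mult_def scaleR_sum_right)

lemma mult_vec_axis: "((A :: quat^'n^'m) *v axis i 1) $ k = A $ k $ i"
  by (simp add: matrix_vector_mult_def axis_def if_distrib cong: if_cong)

lemma hermitian_iff: "hermitian A \<longleftrightarrow> (\<forall>i j. qcnj (A $ j $ i) = A $ i $ j)"
  unfolding hermitian_def conj_transpose_def vec_eq_iff vec_lambda_beta by metis

lemma hermitian_adjoint: "hermitian A \<Longrightarrow> hprod (A *v u) v = hprod u (A *v v)"
  using hprod_conj_transpose[of A u v] unfolding hermitian_def by metis

lemma hform_add:
  assumes "hermitian A"
  shows "hform A (u + v) = hform A u + hform A v + 2 * qRe (hprod u (A *v v))"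
proof -
  have "qRe (hprod v (A *v u)) = qRe (hprod u (A *v v))"
    using hermitian_adjoint[OF assms, of u v] qRe_hprod_commute by metis
  then show ?thesis
    by (simp add: hform_def matrix_vector_right_distrib hprod_add_left hprod_add_right)
qed

lemma hform_scaleR: "hform A (r *\<^sub>R u) = r\<^sup>2 * hform A u"
  by (simp add: hform_def mult_vec_scaleR hprod_scaleR_left hprod_scaleR_right power2_eq_square)

text \<open>The value u^H A u is real, hence central, so \<open>qcnj w\<close> and \<open>w\<close>
  meet and give \<open>qnorm2 w\<close>.\<close>

lemma hform_rmul:
  assumes "hermitian A"
  shows "hform A (rmul u w) = qnorm2 w * hform A u"
proof -
  have "hprod (rmul u w) (A *v rmul u w) = qcnj w * of_real (hform A u) * w"
    by (simp add: mult_vec_rmul hprod_rmul_left hprod_rmul_right hform_real[OF assms] mult.assoc)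
  also have "\<dots> = hform A u *\<^sub>R (qcnj w * w)"
    by (simp add: of_real_def)
  finally show ?thesis
    unfolding hform_def[of A "rmul u w"] by (simp add: qcnj_times_self)
qed

lemma hform_axis: "hform A (axis i 1) = qRe (A $ i $ i)"
  unfolding hform_def hprod_axis_left mult_vec_axis ..

text \<open>The source of all later freedom: \<open>w\<close> enters the square terms only through
  its norm, but the cross term through a real-linear functional.\<close>

lemma hform_scaleR_add_rmul:
  assumes "hermitian A"
  shows "hform A (r *\<^sub>R u + s *\<^sub>R rmul v w) = r\<^sup>2 * hform A u + s\<^sup>2 * (qnorm2 w * hform A v)
    + 2 * (r * s) * qRe (hprod u (A *v v) * w)"
  by (simp add: hform_add[OF assms] hform_scaleR hform_rmul[OF assms] hprod_scaleR_left
      hprod_scaleR_right mult_vec_scaleR mult_vec_rmul hprod_rmul_right)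

section \<open>Rank-one matrices and the trace inner product\<close>

definition outer :: "quat^'n \<Rightarrow> quat^'n^'n" where
  "outer x = (\<chi> i j. x $ i * qcnj (x $ j))"

lemma outer_hermitian: "hermitian (outer x)"
  by (simp add: hermitian_iff outer_def qcnj_mult)

lemma minner_add: "minner A (X + Y) = minner A X + minner A Y"
  by (simp add: minner_def matrix_add_ldistrib trace_def sum.distrib)

lemma minner_zero [simp]: "minner A 0 = 0"
  by (simp add: minner_def trace_def matrix_matrix_mult_def)

lemma minner_sum: "minner A (\<Sum>i\<in>I. X i) = (\<Sum>i\<in>I. minner A (X i))"
  by (induction I rule: infinite_finite_induct) (auto simp: minner_add)

text \<open>Quaternions do not commute, but the real part of a product is invariant under swapping
  its two factors, which gives the usual cyclicity of the trace.\<close>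

lemma minner_outer:
  assumes "hermitian A"
  shows "minner A (outer x) = hform A x"
proof -
  have "minner A (outer x) = (\<Sum>i\<in>UNIV. \<Sum>j\<in>UNIV. qRe (A $ i $ j * (x $ j * qcnj (x $ i))))"
    unfolding minner_def assms[unfolded hermitian_def, symmetric]
    by (simp add: trace_def matrix_matrix_mult_def outer_def qRe_sum)
  also have "\<dots> = (\<Sum>i\<in>UNIV. \<Sum>j\<in>UNIV. qRe (qcnj (x $ i) * (A $ i $ j * x $ j)))"
    by (intro sum.cong refl) (metis mult.assoc qRe_mult_commute)
  also have "\<dots> = hform A x"
    by (simp add: hform_def hprod_def matrix_vector_mult_def qRe_sum sum_distrib_left)
  finally show ?thesis .
qed

lemma outer_mult_vec: "outer x *v u = rmul x (hprod x u)"
  by (simp add: vec_eq_iff outer_def rmul_def matrix_vector_mult_def hprod_def sum_distrib_left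
      mult.assoc)

lemma hform_outer: "hform (outer x) u = qnorm2 (hprod x u)"
  by (metis hform_def outer_mult_vec hprod_rmul_right qcnj_hprod qcnj_times_self qRe_of_real)

lemma psd_outer: "psd (outer x)"
  by (simp add: psd_def outer_hermitian hform_outer)

section \<open>Positive semidefinite matrices as sums of rank-one matrices\<close>

lemma hform_minus_scaleR: "hform (X - r *\<^sub>R Y) u = hform X u - r * hform Y u"
proof -
  have "(X - r *\<^sub>R Y) *v u = X *v u - r *\<^sub>R (Y *v u)"
    by (simp add: vec_eq_iff matrix_vector_mult_def algebra_simps sum_subtractf scaleR_sum_right)
  then show ?thesis
    by (simp add: hform_def hprod_diff_right hprod_scaleR_right)
qed

lemma psd_diag_nonneg: "psd X \<Longrightarrow> 0 \<le> qRe (X $ i $ i)"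
  by (metis hform_axis psd_def)

text \<open>On e_i - e_j \<open>qcnj (X $ i $ j)\<close> the diagonal contributes nothing and the
  form equals -2 |X_ij|^2, so nonnegativity forces X_ij = 0.\<close>

lemma psd_eq_0_if_diag_0:
  assumes "psd X" and "\<And>i. qRe (X $ i $ i) = 0"
  shows "X = 0"
proof -
  have "X $ i $ j = 0" for i j
  proof -
    have "0 \<le> hform X (1 *\<^sub>R axis i 1 + 1 *\<^sub>R rmul (axis j 1) (- qcnj (X $ i $ j)))"
      using assms(1) psd_def by blast
    also have "\<dots> = - 2 * qnorm2 (X $ i $ j)"
      using assms(1) unfolding psd_def
      by (subst hform_scaleR_add_rmul)
        (simp_all add: hform_axis assms(2) hprod_axis_left mult_vec_axis times_qcnj_self)
    finally show ?thesis
      using qnorm2_nonneg[of "X $ i $ j"] qnorm2_eq_0_iff[of "X $ i $ j"] by linarith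
  qed
  then show ?thesis
    by (simp add: vec_eq_iff)
qed

text \<open>Completing the square: the new form at u is the form of X at u - e_i s/a, where a is the
  pivot and s the product of the pivot column with u.\<close>

lemma psd_schur_complement:
  fixes X :: "quat^'n^'n"
  assumes X: "psd X" and pos: "0 < qRe (X $ i $ i)"
  shows "psd (X - (1 / qRe (X $ i $ i)) *\<^sub>R outer (X *v axis i 1))"
    (is "psd (X - (1 / ?a) *\<^sub>R outer ?e)")
proof -
  have herm: "hermitian X"
    using X psd_def by blast
  have "hermitian (X - (1 / ?a) *\<^sub>R outer ?e)"
    using herm outer_hermitian[of ?e] by (simp add: hermitian_iff qcnj_diff qcnj_scaleR)
  moreover have "0 \<le> hform (X - (1 / ?a) *\<^sub>R outer ?e) u" for u
  proof -
    define s where "s = hprod ?e u"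
    have s: "hprod u (X *v axis i 1) = qcnj s"
      by (simp add: s_def qcnj_hprod)
    have "0 \<le> hform X (1 *\<^sub>R u + (- 1 / ?a) *\<^sub>R rmul (axis i 1) s)"
      using X psd_def by blast
    also have "\<dots> = hform X u - (1 / ?a) * qnorm2 s"
      using pos unfolding hform_scaleR_add_rmul[OF herm] s hform_axis qcnj_times_self qRe_of_real
      by (simp add: power2_eq_square field_simps)
    finally show ?thesis
      by (simp add: hform_minus_scaleR hform_outer s_def)
  qed
  ultimately show ?thesis
    by (simp add: psd_def)
qed

lemma outer_scaleR: "outer (r *\<^sub>R x) = r\<^sup>2 *\<^sub>R outer x"
  by (simp add: outer_def vec_eq_iff qcnj_scaleR power2_eq_square)

text \<open>Each elimination step splits off one rank-one matrix and lowers the number of nonzero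
  diagonal entries.\<close>

lemma psd_sum_outer:
  fixes X :: "quat^'n^'n"
  assumes "psd X"
  shows "\<exists>r (x :: nat \<Rightarrow> quat^'n). X = (\<Sum>i<r. outer (x i))"
  using assms
proof (induction "card {i. qRe (X $ i $ i) \<noteq> 0}" arbitrary: X rule: less_induct)
  case less
  show ?case
  proof (cases "\<forall>i. qRe (X $ i $ i) = 0")
    case True
    then have "X = 0"
      using psd_eq_0_if_diag_0[OF less.prems] by simp
    then show ?thesis
      by (intro exI[of _ 0] exI[of _ "\<lambda>_. 0"]) simp
  next
    case False
    then obtain i where i: "qRe (X $ i $ i) \<noteq> 0"
      by blast
    define a where "a = qRe (X $ i $ i)"
    have pos: "0 < a"
      using i psd_diag_nonneg[OF less.prems, of i] by (simp add: a_def)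
    define e where "e = X *v axis i 1"
    define Y where "Y = X - (1 / a) *\<^sub>R outer e"
    have Y: "psd Y"
      using psd_schur_complement[OF less.prems] pos by (simp add: Y_def a_def e_def)
    have diag: "qRe (Y $ k $ k) = qRe (X $ k $ k) - (1 / a) * qnorm2 (hprod e (axis k 1))" for k
      unfolding hform_axis[symmetric] Y_def hform_minus_scaleR hform_outer ..
    \<comment> \<open>Diagonal entries of a Hermitian matrix are real, so subtracting |X_ii|^2 / a
      clears this one.\<close>
    have "X $ i $ i = of_real a"
      using hform_real[of X "axis i 1"] less.prems
      by (simp add: psd_def hprod_axis_left mult_vec_axis hform_axis a_def)
    then have "qRe (Y $ i $ i) = 0"
      unfolding diag using pos
      by (simp add: hprod_axis_right e_def mult_vec_axis quat_of_real qnorm2_def power2_eq_square)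
    \<comment> \<open>Elimination can only lower a diagonal entry, and \<open>Y\<close> is still
      positive semidefinite, so zeros stay zero.\<close>
    moreover have "qRe (Y $ k $ k) = 0" if "qRe (X $ k $ k) = 0" for k
      using psd_diag_nonneg[OF Y, of k] pos that unfolding diag
      by (smt (verit) divide_nonneg_pos mult_nonneg_nonneg qnorm2_nonneg)
    ultimately have "{k. qRe (Y $ k $ k) \<noteq> 0} \<subset> {k. qRe (X $ k $ k) \<noteq> 0}"
      using i by blast
    then have "card {k. qRe (Y $ k $ k) \<noteq> 0} < card {k. qRe (X $ k $ k) \<noteq> 0}"
      by (simp add: psubset_card_mono)
    from less.hyps[OF this Y] obtain r and x :: "nat \<Rightarrow> quat^'n"
      where x: "Y = (\<Sum>i<r. outer (x i))"
      by blast
    define x' where "x' = x(r := (1 / sqrt a) *\<^sub>R e)"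
    have "(\<Sum>i<Suc r. outer (x' i)) = Y + (1 / a) *\<^sub>R outer e"
      using pos by (simp add: x x'_def outer_scaleR power_divide)
    then have "X = (\<Sum>i<Suc r. outer (x' i))"
      by (simp add: Y_def)
    then show ?thesis
      by blast
  qed
qed

section \<open>Real-linear functionals on the four-dimensional space of quaternions\<close>

text \<open>Four functionals form a linear map between real spaces of dimension four, which is
  surjective if it is injective.\<close>

lemma quat_functionals_singular_or_onto:
  fixes a :: "nat \<Rightarrow> quat"
  shows "(\<exists>w. w \<noteq> 0 \<and> (\<forall>j\<in>{1..4}. qRe (a j * w) = 0)) \<or>
    (\<forall>y. \<exists>w. \<forall>j\<in>{1..4}. qRe (a j * w) = y j)"
proof -
  \<comment> \<open>\<open>q\<close> identifies real quadruples with quaternions, so that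
    \<open>f\<close> becomes an endomorphism of a Euclidean space.\<close>
  define q where "q = (\<lambda>(s, t, u, v). Quat s t u v)"
  define f where "f = (\<lambda>p. (qRe (a 1 * q p), qRe (a 2 * q p), qRe (a 3 * q p), qRe (a 4 * q p)))"
  have idx: "{1..4::nat} = {1, 2, 3, 4}"
    by auto
  have q_add: "q (x + y) = q x + q y" and q_scaleR: "q (r *\<^sub>R x) = r *\<^sub>R q x" for x y r
    by (auto simp: q_def quat_eq_iff split: prod.splits)
  have f: "linear f"
    by (rule linearI) (simp_all add: f_def q_add q_scaleR ring_distribs)
  show ?thesis
  proof (cases "inj f")
    case True
    then have "surj f"
      using f linear_injective_imp_surjective by blast
    have "\<exists>w. \<forall>j\<in>{1..4}. qRe (a j * w) = y j" for y
    proof -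
      obtain p where "f p = (y 1, y 2, y 3, y 4)"
        using \<open>surj f\<close> by (metis surjD)
      then show ?thesis
        unfolding idx f_def by auto
    qed
    then show ?thesis
      by blast
  next
    case False
    then obtain p where p: "f p = 0" "p \<noteq> 0"
      using linear_injective_0[OF f] by blast
    have "q p \<noteq> 0"
      using p(2) by (auto simp: q_def quat_eq_iff zero_prod_def split: prod.splits)
    then show ?thesis
      using p(1) unfolding idx f_def zero_prod_def by auto
  qed
qed

text \<open>At most three linear conditions in dimension four have a nonzero solution, which can be
  normalised.\<close>

lemma quat_functionals_kernel:
  fixes a :: "nat \<Rightarrow> quat"
  assumes "k < 4"
  obtains w where "qnorm2 w = 1" and "\<And>j. j \<in> {1..k} \<Longrightarrow> qRe (a j * w) = 0"
proof -
  \<comment> \<open>With a zero functional at index 4 the value 1 is not attained there, which rules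
    out surjectivity; the indices up to \<open>k\<close> are unaffected.\<close>
  define a' where "a' = a(4 := 0)"
  have "\<not> (\<forall>y. \<exists>w. \<forall>j\<in>{1..4}. qRe (a' j * w) = y j)"
    by (auto simp: a'_def intro!: exI[of _ "\<lambda>_. 1"] bexI[of _ 4])
  then obtain w where w: "w \<noteq> 0" "\<And>j. j \<in> {1..4} \<Longrightarrow> qRe (a' j * w) = 0"
    using quat_functionals_singular_or_onto[of a'] by blast
  define v where "v = (1 / sqrt (qnorm2 w)) *\<^sub>R w"
  have pos: "0 < qnorm2 w"
    using w(1) by (rule qnorm2_pos)
  then have "qnorm2 v = 1"
    using w(1) by (simp add: v_def qnorm2_scaleR power_divide)
  moreover have "qRe (a j * v) = 0" if "j \<in> {1..k}" for j
    using w(2)[of j] that assms by (simp add: v_def a'_def)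
  ultimately show thesis
    using that by blast
qed

text \<open>Either a nonzero common zero exists, or all four values can be prescribed as -1, which
  forces \<open>w\<close> to be nonzero.\<close>

lemma quat_functionals_nonpos:
  fixes a :: "nat \<Rightarrow> quat"
  obtains w where "w \<noteq> 0" and "\<And>j. j \<in> {1..4} \<Longrightarrow> qRe (a j * w) \<le> 0"
proof (cases "\<exists>w. w \<noteq> 0 \<and> (\<forall>j\<in>{1..4}. qRe (a j * w) = 0)")
  case True
  then show ?thesis
    using that by (metis order.refl)
next
  case False
  then obtain w where w: "\<forall>j\<in>{1..4}. qRe (a j * w) = - 1"
    using quat_functionals_singular_or_onto[of a] by meson
  then have "w \<noteq> 0"
    by (auto dest!: bspec[of _ _ 1])
  then show ?thesis
    using that w by fastforce
qed

section \<open>Equalising four forms over the summands\<close>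

lemma quadratic_root_if_opposite_signs:
  fixes p m s :: real
  assumes "0 < p" and "s < 0"
  obtains t where "p * t\<^sup>2 + 2 * m * t + s = 0"
proof -
  have "0 < p * (- s)"
    using assms by (intro mult_pos_pos) auto
  then have nonneg: "0 \<le> m\<^sup>2 - p * s"
    using zero_le_power2[of m] by linarith
  have "p * (((- m + sqrt (m\<^sup>2 - p * s)) / p)\<^sup>2) + 2 * m * ((- m + sqrt (m\<^sup>2 - p * s)) / p) + s
    = ((sqrt (m\<^sup>2 - p * s))\<^sup>2 - (m\<^sup>2 - p * s)) / p"
    using assms(1) by (simp add: field_simps power2_eq_square del: real_sqrt_mult_self)
  also have "\<dots> = 0"
    using nonneg by simp
  finally show thesis
    using that by blast
qed

text \<open>The unit quaternion w leaves four real degrees of freedom: three of them make the cross terms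
  of the at most three forms already equalised vanish, and the rotation angle handles the next form.\<close>

lemma rotate_pair:
  fixes F :: "nat \<Rightarrow> quat^'n^'n"
  assumes k: "k < 4" and F: "\<And>j. j \<in> {1..k} \<Longrightarrow> hermitian (F j)" and G: "hermitian G"
    and eq: "\<And>j. j \<in> {1..k} \<Longrightarrow> hform (F j) u = m j \<and> hform (F j) v = m j"
    and less: "hform G v < g" "g < hform G u"
  obtains u' v' where "\<And>B. hermitian B \<Longrightarrow> hform B u' + hform B v' = hform B u + hform B v"
    and "\<And>j. j \<in> {1..k} \<Longrightarrow> hform (F j) u' = m j" and "hform G u' = g"
proof -
  obtain w where w: "qnorm2 w = 1" "\<And>j. j \<in> {1..k} \<Longrightarrow> qRe (hprod u (F j *v v) * w) = 0"
    using quat_functionals_kernel[OF k, of "\<lambda>j. hprod u (F j *v v)"] by metis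
  define h where "h = qRe (hprod u (G *v v) * w)"
  \<comment> \<open>This equation says that the form of \<open>G\<close> at t u + v w is g (1 +
    t^2).\<close>
  obtain t where t: "(hform G u - g) * t\<^sup>2 + 2 * h * t + (hform G v - g) = 0"
    using quadratic_root_if_opposite_signs[of "hform G u - g" "hform G v - g"] less by auto
  \<comment> \<open>This factor makes the change from u, v w to \<open>u'\<close>, \<open>v'\<close>
    orthogonal, so the cross terms cancel in the sum and the square terms are preserved.\<close>
  define n where "n = 1 / sqrt (1 + t\<^sup>2)"
  have pos: "0 < 1 + t\<^sup>2"
    by (simp add: add_pos_nonneg)
  then have n2: "n\<^sup>2 = 1 / (1 + t\<^sup>2)"
    by (simp add: n_def power_divide)
  then have n: "(n * t)\<^sup>2 = t\<^sup>2 / (1 + t\<^sup>2)" "(- n * t)\<^sup>2 = t\<^sup>2 / (1 + t\<^sup>2)"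
      "n * t * n = t / (1 + t\<^sup>2)" "n * (- n * t) = - t / (1 + t\<^sup>2)"
    by (simp_all add: power_mult_distrib flip: mult.assoc)
      (simp_all add: mult.commute[of _ t] mult.assoc flip: power2_eq_square)
  define u' where "u' = (n * t) *\<^sub>R u + n *\<^sub>R rmul v w"
  define v' where "v' = n *\<^sub>R u + (- n * t) *\<^sub>R rmul v w"
  have u': "hform B u' = (t\<^sup>2 * hform B u + hform B v + 2 * t * qRe (hprod u (B *v v) * w)) / (1 + t\<^sup>2)"
    and v': "hform B v' = (hform B u + t\<^sup>2 * hform B v - 2 * t * qRe (hprod u (B *v v) * w)) / (1 + t\<^sup>2)"
    if "hermitian B" for B
    unfolding u'_def v'_def hform_scaleR_add_rmul[OF that] w(1)
      n n2
    by (simp_all add: add_divide_distrib diff_divide_distrib algebra_simps)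
  show thesis
  proof
    fix B :: "quat^'n^'n"
    assume B: "hermitian B"
    have "hform B u' + hform B v' = ((1 + t\<^sup>2) * (hform B u + hform B v)) / (1 + t\<^sup>2)"
      unfolding u'[OF B] v'[OF B] add_divide_distrib[symmetric] by (simp add: algebra_simps)
    then show "hform B u' + hform B v' = hform B u + hform B v"
      using pos by simp
  next
    fix j
    assume j: "j \<in> {1..k}"
    then show "hform (F j) u' = m j"
      using pos unfolding u'[OF F[OF j]] by (simp add: w(2) eq field_simps)
  next
    show "hform G u' = g"
      using pos t unfolding u'[OF G] h_def by (simp add: field_simps)
  qed
qed

lemma exists_above_mean:
  fixes f :: "nat \<Rightarrow> real"
  assumes "(\<Sum>i<r. f i) = real r * g" and "i0 < r" and "f i0 \<noteq> g"
  shows "\<exists>i<r. g < f i"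
proof (rule ccontr)
  assume "\<not> ?thesis"
  then have le: "f i \<le> g" if "i < r" for i
    using that not_less by blast
  then have "f i0 < g"
    using assms(2,3) by (simp add: order_less_le)
  then have "(\<Sum>i<r. f i) < (\<Sum>i<r. g)"
    using le assms(2) by (intro sum_strict_mono_ex1) auto
  then show False
    using assms(1) by simp
qed

text \<open>A vector above the target is paired with one below it. Rotation puts one of them exactly
  on target and spoils no vector already there, so the number of deviating vectors drops.\<close>

lemma equalise_next_form:
  fixes F :: "nat \<Rightarrow> quat^'n^'n" and x :: "nat \<Rightarrow> quat^'n"
  assumes k: "k < 4" and F: "\<And>j. j \<in> {1..k} \<Longrightarrow> hermitian (F j)" and G: "hermitian G"
    and "\<And>i j. i < r \<Longrightarrow> j \<in> {1..k} \<Longrightarrow> hform (F j) (x i) = m j"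
    and "(\<Sum>i<r. hform G (x i)) = real r * g"
  shows "\<exists>y. (\<forall>B. hermitian B \<longrightarrow> (\<Sum>i<r. hform B (y i)) = (\<Sum>i<r. hform B (x i))) \<and>
    (\<forall>i<r. (\<forall>j\<in>{1..k}. hform (F j) (y i) = m j) \<and> hform G (y i) = g)"
  using assms(4,5)
proof (induction "card {i. i < r \<and> hform G (x i) \<noteq> g}" arbitrary: x rule: less_induct)
  case less
  note eq = less.prems(1) and sum = less.prems(2)
  show ?case
  proof (cases "\<forall>i<r. hform G (x i) = g")
    case True
    then show ?thesis
      using eq by blast
  next
    case False
    then obtain i0 where i0: "i0 < r" "hform G (x i0) \<noteq> g"
      by blast
    have "\<exists>i<r. g < hform G (x i)"
      using sum i0 by (rule exists_above_mean)
    then obtain p where p: "p < r" "g < hform G (x p)"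
      by blast
    \<comment> \<open>The same averaging argument for the negated values.\<close>
    have "\<exists>i<r. hform G (x i) < g"
      using exists_above_mean[of "\<lambda>i. - hform G (x i)" r "- g" i0] sum i0 by (simp add: sum_negf)
    then obtain s where s: "s < r" "hform G (x s) < g"
      by blast
    have "p \<noteq> s"
      using p s by auto
    have "hform (F j) (x p) = m j \<and> hform (F j) (x s) = m j" if "j \<in> {1..k}" for j
      using eq p(1) s(1) that by blast
    from rotate_pair[where u = "x p" and v = "x s" and m = m and g = g, OF k F G this s(2) p(2)]
    obtain u v where uv: "\<And>B. hermitian B \<Longrightarrow> hform B u + hform B v = hform B (x p) + hform B (x s)"
      and u: "\<And>j. j \<in> {1..k} \<Longrightarrow> hform (F j) u = m j" "hform G u = g"
      by blast
    define y where "y = x(p := u, s := v)"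
    have split: "(\<Sum>i<r. f i) = f p + f s + (\<Sum>i\<in>{..<r} - {p, s}. f i)" for f :: "nat \<Rightarrow> real"
      using p(1) s(1) \<open>p \<noteq> s\<close> sum.subset_diff[of "{p, s}" "{..<r}" f] by simp
    have y: "(\<Sum>i<r. hform B (y i)) = (\<Sum>i<r. hform B (x i))" if "hermitian B" for B
    proof -
      have "(\<Sum>i\<in>{..<r} - {p, s}. hform B (y i)) = (\<Sum>i\<in>{..<r} - {p, s}. hform B (x i))"
        by (intro sum.cong) (auto simp: y_def)
      then show ?thesis
        using uv[OF that] \<open>p \<noteq> s\<close> by (simp add: split y_def)
    qed
    \<comment> \<open>The rotation preserves the sum 2 \<open>m j\<close>, and \<open>u\<close>
      already takes half of it.\<close>
    have "hform (F j) v = m j" if "j \<in> {1..k}" for j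
      using uv[OF F[OF that]] u(1)[OF that] eq p(1) s(1) that by force
    then have eq': "hform (F j) (y i) = m j" if "i < r" "j \<in> {1..k}" for i j
      using that eq u by (simp add: y_def)
    have sum': "(\<Sum>i<r. hform G (y i)) = real r * g"
      using y[OF G] sum by simp
    have "{i. i < r \<and> hform G (y i) \<noteq> g} \<subset> {i. i < r \<and> hform G (x i) \<noteq> g}"
    proof (rule psubsetI)
      show "{i. i < r \<and> hform G (y i) \<noteq> g} \<subseteq> {i. i < r \<and> hform G (x i) \<noteq> g}"
        using s u(2) by (auto simp: y_def split: if_splits)
      have "p \<notin> {i. i < r \<and> hform G (y i) \<noteq> g}"
        using u(2) \<open>p \<noteq> s\<close> by (simp add: y_def)
      moreover have "p \<in> {i. i < r \<and> hform G (x i) \<noteq> g}"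
        using p by simp
      ultimately show "{i. i < r \<and> hform G (y i) \<noteq> g} \<noteq> {i. i < r \<and> hform G (x i) \<noteq> g}"
        by metis
    qed
    then have "card {i. i < r \<and> hform G (y i) \<noteq> g} < card {i. i < r \<and> hform G (x i) \<noteq> g}"
      by (intro psubset_card_mono) auto
    from less.hyps[OF this eq' sum'] show ?thesis
      using y by auto
  qed
qed

text \<open>The forms are treated one at a time. As every stage preserves the sums of all Hermitian
  forms, the means over the original vectors remain the right targets. Passing from k to k + 1 needs
  k < 4, which is where four constraints are the limit.\<close>

lemma equalise_forms:
  fixes F :: "nat \<Rightarrow> quat^'n^'n" and x :: "nat \<Rightarrow> quat^'n"
  assumes "k \<le> 4" and "\<And>j. j \<in> {1..4} \<Longrightarrow> hermitian (F j)" and "0 < r"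
  shows "\<exists>y. (\<forall>B. hermitian B \<longrightarrow> (\<Sum>i<r. hform B (y i)) = (\<Sum>i<r. hform B (x i))) \<and>
    (\<forall>i<r. \<forall>j\<in>{1..k}. hform (F j) (y i) = (\<Sum>i<r. hform (F j) (x i)) / real r)"
  using assms(1)
proof (induction k)
  case 0
  then show ?case
    by auto
next
  case (Suc k)
  let ?m = "\<lambda>j. (\<Sum>i<r. hform (F j) (x i)) / real r"
  have "k \<le> 4"
    using Suc.prems by simp
  from Suc.IH[OF this] obtain y
    where y: "\<And>B. hermitian B \<Longrightarrow> (\<Sum>i<r. hform B (y i)) = (\<Sum>i<r. hform B (x i))"
    and eq: "\<And>i j. i < r \<Longrightarrow> j \<in> {1..k} \<Longrightarrow> hform (F j) (y i) = ?m j"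
    by blast
  have G: "hermitian (F (Suc k))"
    using assms(2) Suc.prems by simp
  have "(\<Sum>i<r. hform (F (Suc k)) (y i)) = real r * ?m (Suc k)"
    using assms(3) y[OF G] by simp
  then obtain z where "\<forall>B. hermitian B \<longrightarrow> (\<Sum>i<r. hform B (z i)) = (\<Sum>i<r. hform B (y i))"
    and "\<forall>i<r. (\<forall>j\<in>{1..k}. hform (F j) (z i) = ?m j) \<and> hform (F (Suc k)) (z i) = ?m (Suc k)"
    using equalise_next_form[of k F "F (Suc k)" r y ?m "?m (Suc k)"] assms(2) Suc.prems G eq
    by auto
  then show ?case
    using y by (intro exI[of _ z]) (auto simp: le_Suc_eq)
qed

text \<open>Since the constraint values are shared equally, each summand inherits their signs from
  X, while the sums of all other Hermitian forms are kept.\<close>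

lemma psd_decomposition:
  fixes F :: "nat \<Rightarrow> quat^'n^'n"
  assumes X: "psd X" and F: "\<And>j. j \<in> {1..4} \<Longrightarrow> hermitian (F j)"
  shows "\<exists>r (x :: nat \<Rightarrow> quat^'n).
    (\<forall>B. hermitian B \<longrightarrow> minner B X = (\<Sum>i<r. hform B (x i))) \<and>
    (\<forall>i<r. \<forall>j\<in>{1..4}. hform (F j) (x i) = minner (F j) X / real r)"
proof -
  obtain r and x :: "nat \<Rightarrow> quat^'n" where "X = (\<Sum>i<r. outer (x i))"
    using psd_sum_outer[OF X] by blast
  then have x: "minner B X = (\<Sum>i<r. hform B (x i))" if "hermitian B" for B
    using that by (simp add: minner_sum minner_outer)
  show ?thesis
  proof (cases "r = 0")
    case True
    then show ?thesis
      using x by (intro exI[of _ 0] exI[of _ x]) simp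
  next
    case False
    then obtain y
      where y: "\<forall>B. hermitian B \<longrightarrow> (\<Sum>i<r. hform B (y i)) = (\<Sum>i<r. hform B (x i))"
      and eq: "\<forall>i<r. \<forall>j\<in>{1..4}. hform (F j) (y i) = (\<Sum>i<r. hform (F j) (x i)) / real r"
      using equalise_forms[of 4 F r x] F by blast
    have "minner B X = (\<Sum>i<r. hform B (y i))" if "hermitian B" for B
      using x[OF that] y that by metis
    moreover have "hform (F j) (y i) = minner (F j) X / real r" if "i < r" "j \<in> {1..4}" for i j
      using x[OF F[OF that(2)]] eq that by metis
    ultimately show ?thesis
      by blast
  qed
qed

section \<open>Homogenisation by an extra first coordinate\<close>

definition vcons :: "quat \<Rightarrow> quat^'n \<Rightarrow> quat^('n option)" where
  "vcons t y = (\<chi> i. case i of None \<Rightarrow> t | Some k \<Rightarrow> y $ k)"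

lemma sum_UNIV_option:
  fixes f :: "'n::finite option \<Rightarrow> 'b::comm_monoid_add"
  shows "(\<Sum>i\<in>UNIV. f i) = f None + (\<Sum>i\<in>UNIV. f (Some i))"
  by (simp add: UNIV_option_conv sum.reindex)

lemma hermitian_bordered: "hermitian A \<Longrightarrow> hermitian (bordered c b A)"
  by (auto simp: hermitian_iff bordered_def split: option.split)

lemma hermitian_0: "hermitian 0"
  by (simp add: hermitian_iff)

lemma bordered_mult_vcons:
  "bordered c b A *v vcons t y = vcons (of_real c * t + hprod b y) (rmul b t + A *v y)"
  by (auto simp: vec_eq_iff matrix_vector_mult_def bordered_def vcons_def rmul_def hprod_def
      sum_UNIV_option split: option.split)

lemma hprod_vcons: "hprod (vcons s x) (vcons t y) = qcnj s * t + hprod x y"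
  by (simp add: hprod_def vcons_def sum_UNIV_option)

lemma hform_bordered_vcons_1: "hform (bordered c b A) (vcons 1 y) = quadfun A b c y"
  using qRe_hprod_commute[of b y]
  by (simp add: hform_def quadfun_def bordered_mult_vcons hprod_vcons hprod_add_right
      hprod_rmul_right)

lemma hform_bordered_vcons_0: "hform (bordered c b A) (vcons 0 d) = hform A d"
  by (simp add: hform_def bordered_mult_vcons hprod_vcons hprod_add_right hprod_rmul_right)

lemma vcons_eq_rmul:
  assumes "x $ None \<noteq> 0"
  obtains y where "x = rmul (vcons 1 y) (x $ None)"
proof -
  let ?t = "x $ None"
  \<comment> \<open>The inverse of \<open>?t\<close>; multiplying by it on the right makes the first
    coordinate 1.\<close>
  define w where "w = (1 / qnorm2 ?t) *\<^sub>R qcnj ?t"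
  have "w * ?t = 1"
    using assms by (simp add: w_def qcnj_times_self of_real_def)
  then have "x = rmul (vcons 1 (\<chi> k. x $ Some k * w)) ?t"
    by (auto simp: vec_eq_iff rmul_def vcons_def mult.assoc split: option.split)
  then show thesis
    by (rule that)
qed

lemma vcons_exhaust:
  obtains d where "x = vcons (x $ None) d"
proof
  show "x = vcons (x $ None) (\<chi> k. x $ Some k)"
    by (auto simp: vec_eq_iff vcons_def split: option.split)
qed

section \<open>Unboundedness along rays\<close>

lemma quadfun_along_ray:
  assumes "hermitian A"
  shows "quadfun A b c (x + s *\<^sub>R rmul d w) = quadfun A b c x
    + 2 * s * qRe (hprod (A *v x + b) d * w) + s\<^sup>2 * (qnorm2 w * hform A d)"
proof -
  have "qRe (hprod (rmul d w) b) = qRe (hprod b d * w)"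
    by (metis qRe_hprod_commute hprod_rmul_right)
  then show ?thesis
    using hform_scaleR_add_rmul[OF assms, of 1 x s d w]
    by (simp add: quadfun_def hprod_add_left hprod_scaleR_left hermitian_adjoint[OF assms]
        ring_distribs)
qed

lemma quadratic_unbounded:
  fixes \<alpha> \<beta> \<gamma> K :: real
  assumes "0 < \<alpha>"
  obtains s where "0 \<le> s" and "K \<le> \<gamma> + \<beta> * s + \<alpha> * s\<^sup>2"
proof -
  \<comment> \<open>Chosen so that \<beta> + \<alpha> s is at least |\<gamma>| + |K|; as s is at
    least 1, a further factor s does no harm.\<close>
  define s where "s = 1 + (\<bar>\<beta>\<bar> + \<bar>\<gamma>\<bar> + \<bar>K\<bar>) / \<alpha>"
  have s: "1 \<le> s"
    using assms by (simp add: s_def)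
  have "\<alpha> * s = \<alpha> + \<bar>\<beta>\<bar> + \<bar>\<gamma>\<bar> + \<bar>K\<bar>"
    using assms by (simp add: s_def field_simps)
  then have le: "\<bar>\<gamma>\<bar> + \<bar>K\<bar> \<le> \<beta> + \<alpha> * s"
    using assms by linarith
  also have "\<dots> \<le> (\<beta> + \<alpha> * s) * s"
    using mult_left_mono[OF s, of "\<beta> + \<alpha> * s"] le by simp
  also have "\<dots> = \<beta> * s + \<alpha> * s\<^sup>2"
    by (simp add: power2_eq_square algebra_simps)
  finally have "K \<le> \<gamma> + \<beta> * s + \<alpha> * s\<^sup>2"
    by linarith
  then show thesis
    using that[of s] s by simp
qed

text \<open>A suitable nonzero \<open>w\<close> makes all slopes of the constraints at x
  nonpositive, so the whole ray is feasible, while the quadratic coefficient of the objective stays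
  positive.\<close>

lemma opt_value_infinite_if_recession:
  fixes A :: "nat \<Rightarrow> quat^'n^'n"
  assumes Q: "hermitian Q" and A: "\<And>j. j \<in> {1..4} \<Longrightarrow> hermitian (A j)"
    and x: "x \<in> qcqp_feasible A b c"
    and d: "\<And>j. j \<in> {1..4} \<Longrightarrow> hform (A j) d \<le> 0" "0 < hform Q d"
  shows "opt_value (qcqp_feasible A b c) (quadfun Q q 0) = \<infinity>"
proof -
  obtain w where w: "w \<noteq> 0" "\<And>j. j \<in> {1..4} \<Longrightarrow> qRe (hprod (A j *v x + b j) d * w) \<le> 0"
    using quat_functionals_nonpos[of "\<lambda>j. hprod (A j *v x + b j) d"] by blast
  have feas: "x + s *\<^sub>R rmul d w \<in> qcqp_feasible A b c" if "0 \<le> s" for s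
  proof -
    have "quadfun (A j) (b j) (c j) (x + s *\<^sub>R rmul d w) \<le> 0" if j: "j \<in> {1..4}" for j
    proof -
      have "quadfun (A j) (b j) (c j) x \<le> 0"
        using x j by (simp add: qcqp_feasible_def)
      moreover have "2 * s * qRe (hprod (A j *v x + b j) d * w) \<le> 0"
        using w(2)[OF j] \<open>0 \<le> s\<close> by (simp add: mult_nonneg_nonpos)
      moreover have "s\<^sup>2 * (qnorm2 w * hform (A j) d) \<le> 0"
        using d(1)[OF j] by (simp add: mult_nonneg_nonpos)
      ultimately show ?thesis
        unfolding quadfun_along_ray[OF A[OF j]] by linarith
    qed
    then show ?thesis
      by (simp add: qcqp_feasible_def)
  qed
  have "ereal K \<le> opt_value (qcqp_feasible A b c) (quadfun Q q 0)" for K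
  proof -
    obtain s where s: "0 \<le> s"
      "K \<le> quadfun Q q 0 x + 2 * qRe (hprod (Q *v x + q) d * w) * s + qnorm2 w * hform Q d * s\<^sup>2"
      using quadratic_unbounded[of "qnorm2 w * hform Q d" K "quadfun Q q 0 x"
          "2 * qRe (hprod (Q *v x + q) d * w)"] qnorm2_pos[OF w(1)] d(2) mult_pos_pos by metis
    then have "K \<le> quadfun Q q 0 (x + s *\<^sub>R rmul d w)"
      unfolding quadfun_along_ray[OF Q] by (simp add: algebra_simps)
    then show ?thesis
      unfolding opt_value_def by (intro SUP_upper2[OF feas[OF s(1)]]) simp
  qed
  then show ?thesis
    by (metis ereal_top)
qed

section \<open>Comparison of the two problems\<close>

text \<open>Each feasible x lifts to the rank-one matrix of (1, x) with the same objective
  value.\<close>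

lemma qcqp_le_qcqpr:
  assumes Q: "hermitian Q" and A: "\<And>j. j \<in> {1..4} \<Longrightarrow> hermitian (A j)"
  shows "opt_value (qcqp_feasible A b c) (quadfun Q q 0)
    \<le> opt_value (qcqpr_feasible A b c) (minner (bordered 0 q Q))"
  unfolding opt_value_def
proof (rule SUP_mono)
  fix x
  assume x: "x \<in> qcqp_feasible A b c"
  have m: "minner (bordered c' b' A') (outer (vcons 1 x)) = quadfun A' b' c' x"
    if "hermitian A'" for A' b' c'
    using that by (simp add: minner_outer hermitian_bordered hform_bordered_vcons_1)
  \<comment> \<open>The normalisation by B_5 is the bordered form of the constant function 1, so
    \<open>m\<close> covers it too.\<close>
  have "quadfun 0 0 1 x = 1"
    by (simp add: quadfun_def hform_def hprod_def)
  then have "outer (vcons 1 x) \<in> qcqpr_feasible A b c"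
    using x A by (simp add: qcqpr_feasible_def qcqp_feasible_def psd_outer outer_hermitian m hermitian_0)
  then show "\<exists>X\<in>qcqpr_feasible A b c. ereal (quadfun Q q 0 x) \<le> ereal (minner (bordered 0 q Q) X)"
    using m[OF Q] by (intro bexI) auto
qed

text \<open>If all feasible values were below v, the value at X, then summing the comparison of B_0
  with v B_5 over the decomposition would give v < v, because the B_5 values add up to 1.\<close>

lemma qcqpr_feasible_rounding:
  fixes A :: "nat \<Rightarrow> quat^'n^'n"
  assumes Q: "hermitian Q" and A: "\<And>j. j \<in> {1..4} \<Longrightarrow> hermitian (A j)"
    and x0: "x0 \<in> qcqp_feasible A b c"
    and X: "X \<in> qcqpr_feasible A b c"
    and finite: "opt_value (qcqp_feasible A b c) (quadfun Q q 0) \<noteq> \<infinity>"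
  shows "\<exists>x\<in>qcqp_feasible A b c. minner (bordered 0 q Q) X \<le> quadfun Q q 0 x"
proof (rule ccontr)
  let ?F = "\<lambda>j. bordered (c j) (b j) (A j)" and ?B0 = "bordered 0 q Q"
    and ?B5 = "bordered 1 0 0 :: quat^('n option)^('n option)"
  define v where "v = minner ?B0 X"
  assume "\<not> ?thesis"
  then have small: "quadfun Q q 0 x < v" if "x \<in> qcqp_feasible A b c" for x
    using that by (auto simp: v_def not_le)
  have hF: "hermitian (?F j)" if "j \<in> {1..4}" for j
    using A that by (simp add: hermitian_bordered)
  have hB0: "hermitian ?B0" and hB5: "hermitian ?B5"
    using Q by (simp_all add: hermitian_bordered hermitian_0)
  have X': "psd X" "\<And>j. j \<in> {1..4} \<Longrightarrow> minner (?F j) X \<le> 0" "minner ?B5 X = 1"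
    using X by (auto simp: qcqpr_feasible_def)
  obtain r and x :: "nat \<Rightarrow> quat^('n option)"
    where sum_all: "\<forall>B. hermitian B \<longrightarrow> minner B X = (\<Sum>i<r. hform B (x i))"
      and eq: "\<forall>i<r. \<forall>j\<in>{1..4}. hform (?F j) (x i) = minner (?F j) X / real r"
    using psd_decomposition[where F = ?F, OF X'(1) hF] by blast
  have sum: "minner B X = (\<Sum>i<r. hform B (x i))" if "hermitian B" for B
    using sum_all that by blast
  have nonpos: "hform (?F j) (x i) \<le> 0" if "i < r" "j \<in> {1..4}" for i j
    using eq[rule_format, OF that] X'(2)[OF that(2)]
    by (simp add: divide_nonpos_nonneg)
  have pos: "hform ?B0 (x i) < v * hform ?B5 (x i)" if i: "i < r" and t: "x i $ None \<noteq> 0" for i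
  proof -
    obtain y where y: "x i = rmul (vcons 1 y) (x i $ None)"
      using vcons_eq_rmul[OF t] by blast
    have scale: "hform (bordered c' b' A') (x i) = qnorm2 (x i $ None) * quadfun A' b' c' y"
      if "hermitian A'" for A' b' c'
      using hform_rmul[OF hermitian_bordered[OF that]] y hform_bordered_vcons_1 by metis
    have t2: "0 < qnorm2 (x i $ None)"
      using t by (rule qnorm2_pos)
    have "y \<in> qcqp_feasible A b c"
      using nonpos[OF i] scale A t2 by (auto simp: qcqp_feasible_def mult_le_0_iff)
    moreover have "quadfun 0 0 1 y = 1"
      by (simp add: quadfun_def hform_def hprod_def)
    ultimately show ?thesis
      using small t2 by (simp add: scale Q hermitian_0)
  qed
  \<comment> \<open>Such a summand is a direction; a positive value of \<open>Q\<close> on it would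
    make the optimal value infinite.\<close>
  have zero: "hform ?B0 (x i) \<le> 0 \<and> hform ?B5 (x i) = 0" if i: "i < r" and t: "x i $ None = 0" for i
  proof -
    obtain d where d: "x i = vcons 0 d"
      using vcons_exhaust[of "x i"] t by metis
    have "hform (A j) d \<le> 0" if "j \<in> {1..4}" for j
      using nonpos[OF i that] by (simp add: d hform_bordered_vcons_0)
    then have "hform Q d \<le> 0"
      using opt_value_infinite_if_recession[OF Q A x0] finite not_le by metis
    moreover have "hform 0 d = 0"
      by (simp add: hform_def hprod_def)
    ultimately show ?thesis
      by (simp add: d hform_bordered_vcons_0)
  qed
  \<comment> \<open>Needed for one strict inequality in the sum: otherwise all B_5 values vanish and
    could not add up to 1.\<close>
  have "\<exists>i<r. x i $ None \<noteq> 0"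
  proof (rule ccontr)
    assume "\<not> ?thesis"
    then have "(\<Sum>i<r. hform ?B5 (x i)) = 0"
      using zero by simp
    then show False
      using sum[OF hB5] X'(3) by simp
  qed
  then obtain i where i: "i < r" "x i $ None \<noteq> 0"
    by blast
  have "(\<Sum>i<r. hform ?B0 (x i)) < (\<Sum>i<r. v * hform ?B5 (x i))"
  proof (rule sum_strict_mono_ex1)
    show "\<forall>i\<in>{..<r}. hform ?B0 (x i) \<le> v * hform ?B5 (x i)"
      using pos zero by (metis lessThan_iff less_imp_le mult_zero_right)
  qed (use pos i in auto)
  also have "\<dots> = v"
    using sum[OF hB5] X'(3) by (simp flip: sum_distrib_left)
  finally show False
    using sum[OF hB0] by (simp add: v_def)
qed

theorem theorem5:
  fixes Q :: "quat^'n^'n" and q :: "quat^'n"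
    and A :: "nat \<Rightarrow> quat^'n^'n" and b :: "nat \<Rightarrow> quat^'n" and c :: "nat \<Rightarrow> real"
  assumes "hermitian Q"
    and "\<forall>j\<in>{1..4}. hermitian (A j)"
    and slater: "\<exists>x0. \<forall>j\<in>{1..4}. quadfun (A j) (b j) (c j) x0 < 0"
  shows "opt_value (qcqp_feasible A b c) (quadfun Q q 0)
           = opt_value (qcqpr_feasible A b c) (minner (bordered 0 q Q))
       \<and> (\<forall>X. opt_solution (qcqpr_feasible A b c) (minner (bordered 0 q Q)) X
             \<longrightarrow> (\<exists>x. opt_solution (qcqp_feasible A b c) (quadfun Q q 0) x))"
proof -
  let ?V = "opt_value (qcqp_feasible A b c) (quadfun Q q 0)"
    and ?R = "opt_value (qcqpr_feasible A b c) (minner (bordered 0 q Q))"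
  have A: "hermitian (A j)" if "j \<in> {1..4}" for j
    using assms(2) that by blast
  \<comment> \<open>The Slater point serves as the feasible base point of the rays.\<close>
  obtain x0 where x0: "x0 \<in> qcqp_feasible A b c"
    using slater unfolding qcqp_feasible_def by (auto intro: less_imp_le)
  note rounding = qcqpr_feasible_rounding[OF assms(1) A x0]
  have upper: "ereal (quadfun Q q 0 x) \<le> ?V" if "x \<in> qcqp_feasible A b c" for x
    unfolding opt_value_def using that by (rule SUP_upper)
  have "?R \<le> ?V"
  proof (cases "?V = \<infinity>")
    case False
    show ?thesis
      unfolding opt_value_def[of "qcqpr_feasible A b c"]
    proof (rule SUP_least)
      fix X
      assume "X \<in> qcqpr_feasible A b c"
      then show "ereal (minner (bordered 0 q Q) X) \<le> ?V"
        using rounding False upper by (meson ereal_less_eq(3) order_trans)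
    qed
  qed simp
  then have eq: "?V = ?R"
    using qcqp_le_qcqpr[OF assms(1) A] by (intro antisym)
  moreover have "\<exists>x. opt_solution (qcqp_feasible A b c) (quadfun Q q 0) x"
    if X: "opt_solution (qcqpr_feasible A b c) (minner (bordered 0 q Q)) X" for X
  proof -
    have val: "ereal (minner (bordered 0 q Q) X) = ?V"
      using X eq by (simp add: opt_solution_def)
    \<comment> \<open>An attained value is a real number, so \<open>?V\<close> is finite and
      rounding applies to \<open>X\<close>.\<close>
    then obtain x where x: "x \<in> qcqp_feasible A b c" "minner (bordered 0 q Q) X \<le> quadfun Q q 0 x"
      using rounding X by (force simp: opt_solution_def)
    then have "?V \<le> ereal (quadfun Q q 0 x)"
      using val by (metis ereal_less_eq(3))
    then show ?thesis
      using x(1) upper[OF x(1)] unfolding opt_solution_def by (metis antisym)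
  qed
  ultimately show ?thesis
    by blast
qed

end
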